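(* Let $m\ge 1$, $\varepsilon>0$, and let $L\in GL(m,\mathbb{R})$ have all (complex) eigenvalues of modulus less than $1$. Let $A$ be the unique non-empty compact subset of $\mathbb{R}^m$ with $L_\varepsilon(A)=A$. Then $A$ is strictly convex.
   Context: For a non-empty compact set $C\subset\mathbb{R}^m$, $L_\varepsilon(C)=\{x+y \mid x\in L(C),\ \|y\|\le\varepsilon\}$, where $\|\cdot\|$ is the Euclidean norm and $L(C)=\{L(x)\mid x\in C\}$. Under the eigenvalue assumption, $L_\varepsilon$ has exactly one fixed point among the non-empty compact subsets of $\mathbb{R}^m$; this fixed point is $A$. Strictly convex means that for any two distinct points $x,y\in A$ and any $t\in(0,1)$, the point $tx+(1-t)y$ lies in the interior of $A$. *)

theory Defs
  imports "HOL-Analysis.Analysis"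
begin

text \<open>Complex eigenvalues of a real matrix: eigenvalues of its entrywise complexification
  acting on \<open>\<complex>\<^sup>m\<close>.\<close>

definition complex_eigenvalue :: "real^'m^'m \<Rightarrow> complex \<Rightarrow> bool" where
  "complex_eigenvalue L z \<longleftrightarrow>
     (\<exists>v :: complex^'m. v \<noteq> 0 \<and> map_matrix complex_of_real L *v v = z *s v)"

definition L_eps :: "real^'m^'m \<Rightarrow> real \<Rightarrow> (real^'m) set \<Rightarrow> (real^'m) set" where
  "L_eps L \<epsilon> C = {x + y | x y. x \<in> (\<lambda>u. L *v u) ` C \<and> norm y \<le> \<epsilon>}"

definition strictly_convex :: "'a::euclidean_space set \<Rightarrow> bool" where
  "strictly_convex S \<longleftrightarrow>
     (\<forall>x\<in>S. \<forall>y\<in>S. x \<noteq> y \<longrightarrow>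
        (\<forall>t. 0 < t \<and> t < 1 \<longrightarrow> t *\<^sub>R x + (1 - t) *\<^sub>R y \<in> interior S))"

end

theory Submission
  imports Defs
begin

text \<open>
  Write \<open>f\<close> for the linear map and \<open>B\<close> for the closed ball of radius \<open>\<epsilon>\<close>, so that \<open>A = f(A) + B\<close>;
  the lemmas express this sum as a union of balls centred at the points of \<open>f(A)\<close>.

  Since \<open>A\<close> is bounded, the powers of \<open>f\<close> tend to zero on bounded sets: the width of \<open>A\<close> in
  direction \<open>u\<close> is the width in direction \<open>f\<^sup>T u\<close> plus \<open>2\<epsilon>\<parallel>u\<parallel>\<close>, so the series of the
  \<open>\<parallel>(f\<^sup>T)\<^sup>k u\<parallel>\<close> converges (\<open>summable_adjoint_powers\<close>, \<open>funpow_bounded_tendsto_zero\<close>).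

  This contraction is used twice. First, the convex hull \<open>C\<close> of \<open>A\<close> satisfies \<open>C \<subseteq> f(C) + B\<close>.
  Expanding a point of \<open>C\<close> \<open>n\<close> times and then replacing the remainder in \<open>C\<close> by a point of \<open>A\<close>
  gives a point of \<open>A\<close>, at a distance that tends to zero; hence \<open>C = A\<close>
  (\<open>convex_fixed_set\<close>). Second, suppose a segment of \<open>A\<close> from \<open>x\<close> to \<open>y\<close> met the boundary in an
  inner point. A supporting functional \<open>u\<close> there is maximal on \<open>A\<close> at both \<open>x\<close> and \<open>y\<close>. The ball has
  a single maximiser in direction \<open>u\<close>, so \<open>x\<close> and \<open>y\<close> have the same ball component and
  \<open>x - y = f (x' - y')\<close> with \<open>x'\<close>, \<open>y'\<close> maximal in direction \<open>f\<^sup>T u\<close>, which is again nonzero because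
  \<open>f\<close> is onto. Iterating yields \<open>x - y = f\<^sup>n (x\<^sub>n - y\<^sub>n)\<close> with \<open>x\<^sub>n\<close>, \<open>y\<^sub>n\<close> in \<open>A\<close>, and therefore
  \<open>x = y\<close> (\<open>maximiser_unique\<close>).
\<close>

section \<open>The equation of the fixed set\<close>

lemma add_in_fixed_set:
  fixes f :: "'a::euclidean_space \<Rightarrow> 'a"
  assumes "(\<Union>a\<in>A. cball (f a) \<epsilon>) = A" and "a \<in> A" and "norm b \<le> \<epsilon>"
  shows "f a + b \<in> A"
proof -
  have "f a + b \<in> cball (f a) \<epsilon>"
    using assms(3) by (simp add: dist_norm)
  then show ?thesis using assms(1,2) by blast
qed

lemma fixed_set_decompose:
  fixes f :: "'a::euclidean_space \<Rightarrow> 'a"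
  assumes "(\<Union>a\<in>A. cball (f a) \<epsilon>) = A" and "x \<in> A"
  obtains a b where "a \<in> A" "norm b \<le> \<epsilon>" "x = f a + b"
proof -
  obtain a where a: "a \<in> A" "x \<in> cball (f a) \<epsilon>" using assms by blast
  show ?thesis
    by (rule that[of a "x - f a"]) (use a in \<open>auto simp: dist_norm norm_minus_commute\<close>)
qed

section \<open>Width and contraction\<close>

lemma inner_sgn_self: "u \<bullet> sgn u = norm (u :: 'a::real_inner)"
  by (cases "u = 0") (simp_all add: sgn_div_norm dot_square_norm power2_eq_square)

lemma inner_funpow_adjoint:
  fixes f :: "'a::euclidean_space \<Rightarrow> 'a"
  assumes "linear f"
  shows "x \<bullet> (adjoint f ^^ n) u = (f ^^ n) x \<bullet> u"
proof (induction n arbitrary: u)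
  case (Suc n)
  have "x \<bullet> (adjoint f ^^ Suc n) u = (f ^^ n) x \<bullet> adjoint f u"
    by (simp add: funpow_Suc_right Suc del: funpow.simps)
  then show ?case by (simp add: adjoint_works[OF assms])
qed simp

text \<open>Each application of \<open>f\<close> followed by adding the ball widens the set by \<open>2\<epsilon>\<parallel>u\<parallel>\<close> in
  direction \<open>u\<close>, on top of its old width in direction \<open>f\<^sup>T u\<close>. Unfolding this recursion \<open>n\<close> times
  bounds the width from below; two points of the set realise the bound.\<close>

lemma width_fixed_set_ge:
  fixes f :: "'a::euclidean_space \<Rightarrow> 'a"
  assumes "linear f" and "0 < \<epsilon>" and fix_A: "(\<Union>a\<in>A. cball (f a) \<epsilon>) = A" and "A \<noteq> {}"
  shows "\<exists>p\<in>A. \<exists>q\<in>A. 2 * \<epsilon> * (\<Sum>k<n. norm ((adjoint f ^^ k) u)) \<le> u \<bullet> (p - q)"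
proof (induction n arbitrary: u)
  case 0
  obtain a where "a \<in> A" using \<open>A \<noteq> {}\<close> by blast
  then show ?case by (intro bexI[of _ a]) auto
next
  case (Suc n)
  obtain p q where pq: "p \<in> A" "q \<in> A"
    and ge: "2 * \<epsilon> * (\<Sum>k<n. norm ((adjoint f ^^ k) (adjoint f u))) \<le> adjoint f u \<bullet> (p - q)"
    using Suc by blast
  \<comment> \<open>\<open>sgn 0 = 0\<close>, so the choice \<open>\<epsilon> *\<^sub>R sgn u\<close> also covers \<open>u = 0\<close>.\<close>
  define b where "b = \<epsilon> *\<^sub>R sgn u"
  have b: "norm b \<le> \<epsilon>" "u \<bullet> b = \<epsilon> * norm u"
    using \<open>0 < \<epsilon>\<close> by (auto simp: b_def norm_sgn inner_sgn_self)
  have "2 * \<epsilon> * (\<Sum>k<Suc n. norm ((adjoint f ^^ k) u))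
      = 2 * \<epsilon> * (\<Sum>k<n. norm ((adjoint f ^^ k) (adjoint f u))) + 2 * \<epsilon> * norm u"
    unfolding sum.lessThan_Suc_shift
    by (simp add: funpow_Suc_right algebra_simps del: funpow.simps)
  also have "\<dots> \<le> adjoint f u \<bullet> (p - q) + 2 * \<epsilon> * norm u"
    using ge by simp
  also have "\<dots> = u \<bullet> ((f p + b) - (f q + - b))"
    using b(2) adjoint_works[OF \<open>linear f\<close>, of "p - q" u]
    by (simp add: linear_diff[OF \<open>linear f\<close>] inner_commute[of "p - q"] inner_commute[of "adjoint f u"]
        inner_commute[of "f p"] inner_commute[of "f q"] inner_simps)
  finally show ?case
    using add_in_fixed_set[OF fix_A pq(1) b(1)] add_in_fixed_set[OF fix_A pq(2), of "- b"] b(1)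
    by force
qed

lemma summable_adjoint_powers:
  fixes f :: "'a::euclidean_space \<Rightarrow> 'a"
  assumes "linear f" and "0 < \<epsilon>" and "(\<Union>a\<in>A. cball (f a) \<epsilon>) = A" and "A \<noteq> {}" and "bounded A"
  shows "summable (\<lambda>k. norm ((adjoint f ^^ k) u))"
proof (rule summableI_nonneg_bounded)
  fix n
  obtain p q where pq: "p \<in> A" "q \<in> A"
    and ge: "2 * \<epsilon> * (\<Sum>k<n. norm ((adjoint f ^^ k) u)) \<le> u \<bullet> (p - q)"
    using width_fixed_set_ge[OF assms(1-4)] by blast
  note ge
  also have "u \<bullet> (p - q) \<le> norm u * norm (p - q)" by (rule norm_cauchy_schwarz)
  also have "\<dots> \<le> norm u * diameter A"
    using diameter_bounded_bound[OF \<open>bounded A\<close> pq] by (simp add: dist_norm mult_left_mono)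
  finally show "(\<Sum>k<n. norm ((adjoint f ^^ k) u)) \<le> norm u * diameter A / (2 * \<epsilon>)"
    using \<open>0 < \<epsilon>\<close> by (simp add: field_simps)
qed simp

text \<open>The coordinate of \<open>f\<^sup>n x\<close> along a basis vector \<open>b\<close> is the inner product of \<open>x\<close> with
  \<open>(f\<^sup>T)\<^sup>n b\<close>, so pointwise convergence for the adjoint is uniform convergence on bounded sets
  for \<open>f\<close>.\<close>

lemma funpow_bounded_tendsto_zero:
  fixes f :: "'a::euclidean_space \<Rightarrow> 'a"
  assumes "linear f" and "0 < \<epsilon>" and "(\<Union>a\<in>A. cball (f a) \<epsilon>) = A" and "A \<noteq> {}" and "bounded A"
    and "bounded (range x)"
  shows "(\<lambda>n. (f ^^ n) (x n)) \<longlonglongrightarrow> 0"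
proof -
  obtain M where M: "\<And>n. norm (x n) \<le> M"
    using \<open>bounded (range x)\<close> by (auto simp: bounded_iff)
  have "(\<lambda>n. \<Sum>b\<in>Basis. M * norm ((adjoint f ^^ n) b)) \<longlonglongrightarrow> (\<Sum>b\<in>(Basis :: 'a set). M * 0)"
    by (intro tendsto_intros summable_LIMSEQ_zero summable_adjoint_powers[OF assms(1-5)])
  then have lim: "(\<lambda>n. \<Sum>b\<in>Basis. M * norm ((adjoint f ^^ n) (b :: 'a))) \<longlonglongrightarrow> 0"
    by simp
  have le: "norm ((f ^^ n) (x n)) \<le> (\<Sum>b\<in>Basis. M * norm ((adjoint f ^^ n) b))" for n
  proof -
    have "norm ((f ^^ n) (x n)) \<le> (\<Sum>b\<in>Basis. \<bar>(f ^^ n) (x n) \<bullet> b\<bar>)"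
      by (rule norm_le_l1)
    also have "\<dots> \<le> (\<Sum>b\<in>Basis. M * norm ((adjoint f ^^ n) b))"
    proof (rule sum_mono)
      fix b :: 'a
      have "\<bar>(f ^^ n) (x n) \<bullet> b\<bar> \<le> norm (x n) * norm ((adjoint f ^^ n) b)"
        by (simp add: inner_funpow_adjoint[OF \<open>linear f\<close>, symmetric] Cauchy_Schwarz_ineq2)
      also have "\<dots> \<le> M * norm ((adjoint f ^^ n) b)"
        by (simp add: M mult_right_mono)
      finally show "\<bar>(f ^^ n) (x n) \<bullet> b\<bar> \<le> M * norm ((adjoint f ^^ n) b)" .
    qed
    finally show ?thesis .
  qed
  show ?thesis
    by (rule Lim_null_comparison[OF _ lim]) (simp add: le)
qed

section \<open>Convexity\<close>

lemma convex_hull_fixed_set_decompose: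
  fixes f :: "'a::euclidean_space \<Rightarrow> 'a"
  assumes "linear f" and fix_A: "(\<Union>a\<in>A. cball (f a) \<epsilon>) = A" and "c \<in> convex hull A"
  obtains c' b where "c' \<in> convex hull A" "norm b \<le> \<epsilon>" "c = f c' + b"
proof -
  let ?S = "\<Union>x\<in>f ` (convex hull A). \<Union>y\<in>cball 0 \<epsilon>. {x + y}"
  have "A \<subseteq> ?S"
  proof
    fix x assume "x \<in> A"
    then obtain a b where "a \<in> A" "norm b \<le> \<epsilon>" "x = f a + b"
      by (rule fixed_set_decompose[OF fix_A])
    then show "x \<in> ?S"
      using hull_inc[of a A convex] by (intro UN_I[of "f a"] UN_I[of b]) simp_all
  qed
  moreover have "convex ?S"
    by (intro convex_sums convex_linear_image convex_convex_hull convex_cball \<open>linear f\<close>)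
  ultimately have "convex hull A \<subseteq> ?S" by (rule hull_minimal)
  then show ?thesis using \<open>c \<in> convex hull A\<close> that by auto
qed

text \<open>The \<open>n\<close>-fold expansion of a point of the hull leaves a remainder \<open>f\<^sup>n c'\<close>. Putting a fixed
  point \<open>a\<^sub>0\<close> of \<open>A\<close> in place of \<open>c'\<close> changes the point by an amount that tends to zero.\<close>

lemma convex_fixed_set:
  fixes f :: "'a::euclidean_space \<Rightarrow> 'a"
  assumes "linear f" and "0 < \<epsilon>" and fix_A: "(\<Union>a\<in>A. cball (f a) \<epsilon>) = A" and "A \<noteq> {}" and "compact A"
  shows "convex A"
proof -
  have "bounded A" using \<open>compact A\<close> by (rule compact_imp_bounded)
  obtain a0 where "a0 \<in> A" using \<open>A \<noteq> {}\<close> by blast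
  have approx: "\<exists>a\<in>A. \<exists>c'\<in>convex hull A. c - a = (f ^^ n) (c' - a0)"
    if "c \<in> convex hull A" for c n
    using that
  proof (induction n arbitrary: c)
    case 0
    then show ?case using \<open>a0 \<in> A\<close> by auto
  next
    case (Suc n)
    obtain c1 b where c1: "c1 \<in> convex hull A" "norm b \<le> \<epsilon>" "c = f c1 + b"
      using convex_hull_fixed_set_decompose[OF \<open>linear f\<close> fix_A Suc.prems] .
    obtain a c' where a: "a \<in> A" "c' \<in> convex hull A" "c1 - a = (f ^^ n) (c' - a0)"
      using Suc.IH[OF c1(1)] by blast
    have "c - (f a + b) = (f ^^ Suc n) (c' - a0)"
      using a(3)[symmetric] by (simp add: c1(3) linear_diff[OF \<open>linear f\<close>])
    then show ?case using add_in_fixed_set[OF fix_A a(1) c1(2)] a(2) by blast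
  qed
  have "c \<in> A" if c: "c \<in> convex hull A" for c
  proof -
    obtain a c' where ac: "\<And>n. a n \<in> A" "\<And>n. c' n \<in> convex hull A"
        "\<And>n. c - a n = (f ^^ n) (c' n - a0)"
      using approx[OF c] by metis
    have "bounded ((\<lambda>x. x - a0) ` (convex hull A))"
      by (intro bounded_translation_minus bounded_convex_hull \<open>bounded A\<close>)
    then have "bounded (range (\<lambda>n. c' n - a0))"
      by (rule bounded_subset) (use ac(2) in auto)
    then have "(\<lambda>n. c - a n) \<longlonglongrightarrow> 0"
      unfolding ac(3)
      using funpow_bounded_tendsto_zero[OF assms(1-4) \<open>bounded A\<close>] by blast
    then have "(\<lambda>n. c - (c - a n)) \<longlonglongrightarrow> c - 0"
      by (intro tendsto_intros)
    then have "a \<longlonglongrightarrow> c" by simp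
    then show ?thesis
      using closed_sequentially[OF compact_imp_closed[OF \<open>compact A\<close>]] ac(1) by blast
  qed
  then have "convex hull A = A" by (auto intro: hull_inc)
  then show ?thesis by (metis convex_convex_hull)
qed

section \<open>Uniqueness of maximisers of linear functionals\<close>

text \<open>At a maximiser of \<open>u\<close> both summands are maximal separately. For the ball this forces the
  summand \<open>\<epsilon> u / \<parallel>u\<parallel>\<close>, the equality case of the Cauchy--Schwarz inequality.\<close>

lemma maximiser_decompose:
  fixes f :: "'a::euclidean_space \<Rightarrow> 'a"
  assumes "linear f" and "0 < \<epsilon>" and fix_A: "(\<Union>a\<in>A. cball (f a) \<epsilon>) = A"
    and "u \<noteq> 0" and "x \<in> A" and max_x: "\<And>a. a \<in> A \<Longrightarrow> u \<bullet> a \<le> u \<bullet> x"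
  obtains x' where "x' \<in> A" "\<And>a. a \<in> A \<Longrightarrow> adjoint f u \<bullet> a \<le> adjoint f u \<bullet> x'"
    "x = f x' + \<epsilon> *\<^sub>R sgn u"
proof -
  obtain x' b where x': "x' \<in> A" "norm b \<le> \<epsilon>" "x = f x' + b"
    using fixed_set_decompose[OF fix_A \<open>x \<in> A\<close>] .
  have "adjoint f u \<bullet> a \<le> adjoint f u \<bullet> x'" if "a \<in> A" for a
  proof -
    have "u \<bullet> f a \<le> u \<bullet> f x'"
      using max_x[OF add_in_fixed_set[OF fix_A that x'(2)]] by (simp add: x'(3) inner_simps)
    then show ?thesis
      by (metis adjoint_works[OF \<open>linear f\<close>] inner_commute)
  qed
  moreover have "b = \<epsilon> *\<^sub>R sgn u"
  proof -
    have "norm (\<epsilon> *\<^sub>R sgn u) \<le> \<epsilon>"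
      using \<open>0 < \<epsilon>\<close> by (simp add: norm_sgn)
    then have "u \<bullet> (\<epsilon> *\<^sub>R sgn u) \<le> u \<bullet> b"
      using max_x[OF add_in_fixed_set[OF fix_A x'(1), of "\<epsilon> *\<^sub>R sgn u"]]
      by (simp add: x'(3) inner_add_right)
    then have "\<epsilon> * norm u \<le> u \<bullet> b"
      by (simp add: inner_sgn_self)
    then have "\<epsilon> \<le> sgn u \<bullet> b"
      using \<open>u \<noteq> 0\<close> by (simp add: sgn_div_norm field_simps)
    then have "\<epsilon> * \<epsilon> \<le> \<epsilon> * (sgn u \<bullet> b)"
      using \<open>0 < \<epsilon>\<close> by simp
    moreover have "(norm (b - \<epsilon> *\<^sub>R sgn u))\<^sup>2 = (norm b)\<^sup>2 - 2 * (\<epsilon> * (sgn u \<bullet> b)) + \<epsilon>\<^sup>2"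
      using \<open>u \<noteq> 0\<close> dot_norm_neg[of b "\<epsilon> *\<^sub>R sgn u"]
      by (simp add: norm_sgn inner_commute)
    moreover have "(norm b)\<^sup>2 \<le> \<epsilon>\<^sup>2"
      using x'(2) by (simp add: power_mono)
    ultimately have "(norm (b - \<epsilon> *\<^sub>R sgn u))\<^sup>2 \<le> 0"
      by (simp add: power2_eq_square)
    then show ?thesis by simp
  qed
  ultimately show ?thesis using that x' by blast
qed

text \<open>The ball component of a maximiser depends only on the direction, so it cancels in the
  difference of two maximisers; this difference therefore lies in \<open>f\<^sup>n (A - A)\<close> for every \<open>n\<close>.
  Surjectivity of \<open>f\<close> keeps the directions \<open>(f\<^sup>T)\<^sup>n u\<close> nonzero.\<close>

lemma maximiser_unique:
  fixes f :: "'a::euclidean_space \<Rightarrow> 'a"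
  assumes "linear f" and "surj f" and "0 < \<epsilon>" and fix_A: "(\<Union>a\<in>A. cball (f a) \<epsilon>) = A"
    and "bounded A" and "u \<noteq> 0"
    and "x \<in> A" and "\<And>a. a \<in> A \<Longrightarrow> u \<bullet> a \<le> u \<bullet> x"
    and "y \<in> A" and "\<And>a. a \<in> A \<Longrightarrow> u \<bullet> a \<le> u \<bullet> y"
  shows "x = y"
proof -
  have nz: "adjoint f v \<noteq> 0" if "v \<noteq> 0" for v
  proof
    assume "adjoint f v = 0"
    moreover obtain z where "v = f z" using \<open>surj f\<close> by (meson surjD)
    ultimately have "v \<bullet> v = 0"
      using adjoint_works[OF \<open>linear f\<close>, of z v] by simp
    then show False using that by simp
  qed
  have "\<exists>x'\<in>A. \<exists>y'\<in>A. x - y = (f ^^ n) (x' - y')" for n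
    using assms(6-10)
  proof (induction n arbitrary: u x y)
    case 0
    then show ?case by auto
  next
    case (Suc n)
    obtain x1 where x1: "x1 \<in> A" "\<And>a. a \<in> A \<Longrightarrow> adjoint f u \<bullet> a \<le> adjoint f u \<bullet> x1"
        "x = f x1 + \<epsilon> *\<^sub>R sgn u"
      using maximiser_decompose[OF \<open>linear f\<close> \<open>0 < \<epsilon>\<close> fix_A Suc.prems(1-3)] by blast
    obtain y1 where y1: "y1 \<in> A" "\<And>a. a \<in> A \<Longrightarrow> adjoint f u \<bullet> a \<le> adjoint f u \<bullet> y1"
        "y = f y1 + \<epsilon> *\<^sub>R sgn u"
      using maximiser_decompose[OF \<open>linear f\<close> \<open>0 < \<epsilon>\<close> fix_A Suc.prems(1,4,5)] by blast
    obtain x' y' where "x' \<in> A" "y' \<in> A" "x1 - y1 = (f ^^ n) (x' - y')"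
      using Suc.IH[OF nz[OF Suc.prems(1)] x1(1,2) y1(1,2)] by blast
    moreover from this(3) have "x - y = (f ^^ Suc n) (x' - y')"
      by (simp add: x1(3) y1(3) linear_diff[OF \<open>linear f\<close>] flip: \<open>x1 - y1 = _\<close>)
    ultimately show ?case by blast
  qed
  then obtain p q where pq: "\<And>n. p n \<in> A" "\<And>n. q n \<in> A" "\<And>n. x - y = (f ^^ n) (p n - q n)"
    by metis
  have "bounded (\<Union>a\<in>A. \<Union>b\<in>A. {a - b})"
    by (rule bounded_minus[OF \<open>bounded A\<close> \<open>bounded A\<close>, THEN bounded_subset]) auto
  then have "bounded (range (\<lambda>n. p n - q n))"
    by (rule bounded_subset) (use pq in blast)
  then have "(\<lambda>n. (f ^^ n) (p n - q n)) \<longlonglongrightarrow> 0"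
    using funpow_bounded_tendsto_zero[OF \<open>linear f\<close> \<open>0 < \<epsilon>\<close> fix_A _ \<open>bounded A\<close>] \<open>x \<in> A\<close>
    by blast
  then have "(\<lambda>n::nat. x - y) \<longlonglongrightarrow> 0"
    by (simp flip: pq(3))
  then show ?thesis by (simp add: LIMSEQ_const_iff)
qed

section \<open>Strict convexity\<close>

theorem proposition4p2:
  fixes L :: "real^'m^'m" and \<epsilon> :: real and A :: "(real^'m) set"
  assumes "\<epsilon> > 0"
    and "invertible L"
    and "\<And>z. complex_eigenvalue L z \<Longrightarrow> cmod z < 1"
    and "A \<noteq> {}" and "compact A" and "L_eps L \<epsilon> A = A"
  shows "strictly_convex A"
proof -
  let ?f = "\<lambda>x. L *v x"
  have lin: "linear ?f" by (rule matrix_vector_mul_linear)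
  have surj: "surj ?f"
    using \<open>invertible L\<close> by (simp add: invertible_right_inverse matrix_right_invertible_surjective)
  have "L_eps L \<epsilon> A = (\<Union>a\<in>A. cball (?f a) \<epsilon>)"
  proof (intro equalityI subsetI)
    fix z assume "z \<in> (\<Union>a\<in>A. cball (?f a) \<epsilon>)"
    then obtain a where "a \<in> A" "norm (z - ?f a) \<le> \<epsilon>"
      by (auto simp: dist_norm norm_minus_commute)
    moreover have "z = ?f a + (z - ?f a)" by simp
    ultimately show "z \<in> L_eps L \<epsilon> A" unfolding L_eps_def by blast
  next
    fix z assume "z \<in> L_eps L \<epsilon> A"
    then obtain a b where "a \<in> A" "norm b \<le> \<epsilon>" "z = ?f a + b"
      by (auto simp: L_eps_def)
    then show "z \<in> (\<Union>a\<in>A. cball (?f a) \<epsilon>)"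
      by (intro UN_I[of a]) (simp_all add: dist_norm)
  qed
  then have fix_A: "(\<Union>a\<in>A. cball (?f a) \<epsilon>) = A"
    using assms(6) by simp
  have "convex A"
    using convex_fixed_set[OF lin \<open>\<epsilon> > 0\<close> fix_A assms(4,5)] .
  obtain a0 where "a0 \<in> A" using \<open>A \<noteq> {}\<close> by blast
  have "ball (?f a0) \<epsilon> \<subseteq> interior A"
    using fix_A \<open>a0 \<in> A\<close> ball_subset_cball by (intro interior_maximal) blast+
  then have "interior A \<noteq> {}"
    using \<open>\<epsilon> > 0\<close> by (metis ball_eq_empty not_le subset_empty)
  then have rel: "rel_interior A = interior A"
    by (rule rel_interior_nonempty_interior)
  show ?thesis
    unfolding strictly_convex_def
  proof (intro ballI impI allI, rule ccontr)
    fix x y and t :: real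
    assume xy: "x \<in> A" "y \<in> A" "x \<noteq> y" and t: "0 < t \<and> t < 1"
    define p where "p = t *\<^sub>R x + (1 - t) *\<^sub>R y"
    assume "t *\<^sub>R x + (1 - t) *\<^sub>R y \<notin> interior A"
    then have "p \<notin> rel_interior A" by (simp add: rel p_def)
    moreover have "p \<in> A"
      unfolding p_def using convexD[OF \<open>convex A\<close> xy(1,2)] t by simp
    ultimately obtain v where v: "v \<noteq> 0" "\<And>a. a \<in> A \<Longrightarrow> v \<bullet> p \<le> v \<bullet> a"
      using supporting_hyperplane_rel_boundary[OF \<open>convex A\<close>] by metis
    define u where "u = - v"
    have u: "u \<noteq> 0" "\<And>a. a \<in> A \<Longrightarrow> u \<bullet> a \<le> u \<bullet> p"
      using v by (auto simp: u_def)
    \<comment> \<open>The value at \<open>p\<close> is a proper average of the values at \<open>x\<close> and \<open>y\<close>, neither of which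
      exceeds it; so all three agree.\<close>
    have "t * (u \<bullet> p - u \<bullet> x) + (1 - t) * (u \<bullet> p - u \<bullet> y) = 0"
      by (simp add: p_def inner_simps algebra_simps)
    moreover have "0 \<le> t * (u \<bullet> p - u \<bullet> x)" "0 \<le> (1 - t) * (u \<bullet> p - u \<bullet> y)"
      using u(2) xy t by simp_all
    ultimately have "t * (u \<bullet> p - u \<bullet> x) = 0" "(1 - t) * (u \<bullet> p - u \<bullet> y) = 0"
      by linarith+
    then have "u \<bullet> x = u \<bullet> p" "u \<bullet> y = u \<bullet> p"
      using t by auto
    then have "x = y"
      using maximiser_unique[OF lin surj \<open>\<epsilon> > 0\<close> fix_A compact_imp_bounded[OF \<open>compact A\<close>] u(1)]
        u(2) xy by metis
    then show False using xy(3) by simp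
  qed
qed

end
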